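(* Let $n\ge 2$, let $A=(a_{ij})\in\mathbf{M}_n(\mathbb{R})$, and set $d:=a_{11}a_{22}\cdots a_{nn}$ and $c:=a_{12}a_{23}\cdots a_{(n-1)n}a_{n1}$. Then the following hold. (1) $A$ is an inverse $M$-matrix such that $A^{-1}$ is a bdsw matrix if and only if $A>0$, $d-c>0$ and $A$ has the inverse cyclic property. (2) Suppose $n$ is even. Then $A$ is an inverse $N$-matrix such that $A^{-1}$ is a bdsw matrix if and only if $A<0$, $A$ has the inverse cyclic property and $d-c<0$. (3) Suppose $n$ is odd. Then $A$ is an inverse $N$-matrix such that $A^{-1}$ is a bdsw matrix if and only if $A<0$, $A$ has the inverse cyclic property and $d-c>0$.
   Context: $\mathbf{M}_n(\mathbb{R})$ is the set of real $n\times n$ matrices. For a matrix $X$, $X\ge 0$ means that all entries of $X$ are nonnegative, and $X>0$ (respectively $X<0$) means that all entries of $X$ are positive (respectively negative). $\rho(X)$ denotes the spectral radius of $X$. A matrix $X=(x_{ij})\in\mathbf{M}_n(\mathbb{R})$ is a $Z$-matrix if $x_{ij}\le 0$ for all $i\neq j$; equivalently, $X=tI-B$ for some $t\in\mathbb{R}$ and some $B\ge 0$. For $B\ge 0$ and $1\le r\le n$, let $\rho_r(B):=\max\{\rho(\hat B): \hat B \text{ is a principal submatrix of } B \text{ of order } r\}$. A $Z$-matrix $X=tI-B$ ($B\ge 0$) is an $M$-matrix if $t\ge\rho(B)$; for $n\ge 2$ it is an $N$-matrix if $\rho_{n-1}(B)<t<\rho(B)$. (These properties do not depend on the chosen representation.)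 A nonsingular matrix $A$ is called an inverse $M$-matrix (respectively, inverse $N$-matrix) if $A^{-1}$ is an $M$-matrix (respectively, an $N$-matrix). A matrix $A=(a_{ij})\in\mathbf{M}_n(\mathbb{R})$ with $a_{ii}\neq 0$ for all $1\le i\le n$ is said to have the inverse cyclic property if its entries satisfy all of the following: (i) $a_{ij}=\dfrac{a_{ik}a_{kj}}{a_{kk}}$ for all $i<k<j$; (ii) $a_{ij}=\dfrac{a_{in}a_{nj}}{a_{nn}}$ for all $j<i$ with $i\neq n$; (iii) $a_{nj}=\dfrac{a_{n1}a_{1j}}{a_{11}}$ for all $j<n$. A matrix $B=(b_{ij})\in\mathbf{M}_n(\mathbb{R})$ is called a bi-diagonal south-west matrix (bdsw, for short) if all the entries on the main diagonal ($b_{ii}$, $1\le i\le n$), on the superdiagonal ($b_{i,i+1}$, $1\le i\le n-1$), and the entry $b_{n1}$ in the south-west corner are nonzero, while all the other entries are zero. *)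

theory Defs
  imports
    "Jordan_Normal_Form.Matrix"
    "Jordan_Normal_Form.DL_Submatrix"
    "Jordan_Normal_Form.Gauss_Jordan_Elimination"
    "Jordan_Normal_Form.Spectral_Radius"
begin

text \<open>Rows and columns of \<open>A :: real mat\<close> are numbered from 0, so the entry written
  \<open>a\<^sub>i\<^sub>j\<close> with \<open>1 \<le> i, j \<le> n\<close> is \<open>A $$ (i - 1, j - 1)\<close>, and the index \<open>n\<close> becomes \<open>n - 1\<close>.\<close>

definition nonneg_mat :: "real mat \<Rightarrow> bool" where
  "nonneg_mat X \<longleftrightarrow> (\<forall>i < dim_row X. \<forall>j < dim_col X. 0 \<le> X $$ (i, j))"

definition pos_mat :: "real mat \<Rightarrow> bool" where
  "pos_mat X \<longleftrightarrow> (\<forall>i < dim_row X. \<forall>j < dim_col X. 0 < X $$ (i, j))"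

definition neg_mat :: "real mat \<Rightarrow> bool" where
  "neg_mat X \<longleftrightarrow> (\<forall>i < dim_row X. \<forall>j < dim_col X. X $$ (i, j) < 0)"

text \<open>The spectral radius of a real matrix ranges over its complex eigenvalues.\<close>

definition rho :: "real mat \<Rightarrow> real" where
  "rho B = spectral_radius (map_mat complex_of_real B)"

text \<open>Meaningful for \<open>B\<close> of order \<open>n\<close> and \<open>1 \<le> r \<le> n\<close>.\<close>

definition rho_sub :: "nat \<Rightarrow> real mat \<Rightarrow> real" where
  "rho_sub r B = Max {rho (submatrix B I I) | I. I \<subseteq> {..<dim_row B} \<and> card I = r}"

definition Z_matrix :: "nat \<Rightarrow> real mat \<Rightarrow> bool" where
  "Z_matrix n X \<longleftrightarrow> X \<in> carrier_mat n n \<and> (\<forall>i < n. \<forall>j < n. i \<noteq> j \<longrightarrow> X $$ (i, j) \<le> 0)"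

definition Z_rep :: "nat \<Rightarrow> real mat \<Rightarrow> real \<Rightarrow> real mat \<Rightarrow> bool" where
  "Z_rep n X t B \<longleftrightarrow> B \<in> carrier_mat n n \<and> nonneg_mat B \<and> X = t \<cdot>\<^sub>m 1\<^sub>m n - B"

lemma Z_matrix_iff_rep: "Z_matrix n X \<longleftrightarrow> (\<exists>t B. Z_rep n X t B)"
proof
  assume Z: "Z_matrix n X"
  define t where "t = (\<Sum>i<n. \<bar>X $$ (i, i)\<bar>)"
  have t: "X $$ (i, i) \<le> t" if "i < n" for i
  proof -
    have "\<bar>X $$ (i, i)\<bar> \<le> t"
      unfolding t_def by (rule member_le_sum) (use that in auto)
    then show ?thesis by linarith
  qed
  define B where "B = t \<cdot>\<^sub>m 1\<^sub>m n - X"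
  have "Z_rep n X t B"
    unfolding Z_rep_def nonneg_mat_def
  proof (intro conjI allI impI)
    show "B \<in> carrier_mat n n" "X = t \<cdot>\<^sub>m 1\<^sub>m n - B"
      using Z by (auto simp: B_def Z_matrix_def)
    fix i j assume "i < dim_row B" "j < dim_col B"
    then show "0 \<le> B $$ (i, j)"
      using Z t by (cases "i = j") (auto simp: B_def Z_matrix_def)
  qed
  then show "\<exists>t B. Z_rep n X t B" by blast
next
  assume "\<exists>t B. Z_rep n X t B"
  then show "Z_matrix n X" by (auto simp: Z_rep_def Z_matrix_def nonneg_mat_def)
qed

text \<open>The choice of the representation \<open>X = tI - B\<close> is immaterial: two of them
  differ by a shift \<open>(t + s, B + sI)\<close>, which moves all the spectral radii involved by \<open>s\<close>.\<close>

definition M_matrix :: "nat \<Rightarrow> real mat \<Rightarrow> bool" where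
  "M_matrix n X \<longleftrightarrow> (\<exists>t B. Z_rep n X t B \<and> rho B \<le> t)"

definition N_matrix :: "nat \<Rightarrow> real mat \<Rightarrow> bool" where
  "N_matrix n X \<longleftrightarrow> 2 \<le> n \<and> (\<exists>t B. Z_rep n X t B \<and> rho_sub (n - 1) B < t \<and> t < rho B)"

text \<open>\<open>mat_inverse\<close> returns \<open>None\<close> on singular matrices, so \<open>inv_mat A\<close> is used only
  together with \<open>invertible_mat A\<close>.\<close>

definition inv_mat :: "real mat \<Rightarrow> real mat" where
  "inv_mat A = the (mat_inverse A)"

lemma inv_mat:
  assumes A: "A \<in> carrier_mat n n" and inv: "invertible_mat A"
  shows "inv_mat A \<in> carrier_mat n n" "A * inv_mat A = 1\<^sub>m n" "inv_mat A * A = 1\<^sub>m n"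
proof -
  obtain B where "A * B = 1\<^sub>m n" "B * A = 1\<^sub>m (dim_row B)"
    using inv A by (auto simp: invertible_mat_def inverts_mat_def)
  moreover from this have "B \<in> carrier_mat n n"
    using A by (metis carrier_matD(2) carrier_matI index_mult_mat(3) index_one_mat(3))
  ultimately have "A \<in> Units (ring_mat TYPE(real) n ())"
    using A by (auto simp: Units_def ring_mat_def)
  then obtain C where C: "mat_inverse A = Some C"
    using mat_inverse(1)[OF A, of "()"] by (cases "mat_inverse A") auto
  show "inv_mat A \<in> carrier_mat n n" "A * inv_mat A = 1\<^sub>m n" "inv_mat A * A = 1\<^sub>m n"
    using mat_inverse(2)[OF A C] by (auto simp: inv_mat_def C)
qed

definition inverse_M_matrix :: "nat \<Rightarrow> real mat \<Rightarrow> bool" where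
  "inverse_M_matrix n A \<longleftrightarrow>
     A \<in> carrier_mat n n \<and> invertible_mat A \<and> M_matrix n (inv_mat A)"

definition inverse_N_matrix :: "nat \<Rightarrow> real mat \<Rightarrow> bool" where
  "inverse_N_matrix n A \<longleftrightarrow>
     A \<in> carrier_mat n n \<and> invertible_mat A \<and> N_matrix n (inv_mat A)"

definition inverse_cyclic :: "nat \<Rightarrow> real mat \<Rightarrow> bool" where
  "inverse_cyclic n A \<longleftrightarrow>
     A \<in> carrier_mat n n \<and>
     (\<forall>i < n. A $$ (i, i) \<noteq> 0) \<and>
     (\<forall>i k j. i < k \<and> k < j \<and> j < n \<longrightarrow>
        A $$ (i, j) = A $$ (i, k) * A $$ (k, j) / A $$ (k, k)) \<and>
     (\<forall>i j. j < i \<and> i < n \<and> i \<noteq> n - 1 \<longrightarrow>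
        A $$ (i, j) = A $$ (i, n - 1) * A $$ (n - 1, j) / A $$ (n - 1, n - 1)) \<and>
     (\<forall>j < n - 1. A $$ (n - 1, j) = A $$ (n - 1, 0) * A $$ (0, j) / A $$ (0, 0))"

text \<open>Bi-diagonal south-west matrices. For \<open>n = 2\<close> no entry is required to vanish.\<close>

definition bdsw :: "nat \<Rightarrow> real mat \<Rightarrow> bool" where
  "bdsw n B \<longleftrightarrow>
     B \<in> carrier_mat n n \<and>
     (\<forall>i < n. \<forall>j < n.
        B $$ (i, j) \<noteq> 0 \<longleftrightarrow> j = i \<or> j = i + 1 \<or> (i = n - 1 \<and> j = 0))"

end

theory Submission
  imports Defs
begin

text \<open>
  A bi-diagonal south-west matrix \<open>B\<close> acts on a vector by \<open>p\<^sub>i v\<^sub>i - r\<^sub>i v\<^sub>\<sigma>\<^sub>(\<^sub>i\<^sub>)\<close>, where \<open>\<sigma>\<close> is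
  the cyclic successor (\<open>cyc_bidiag\<close>). Write \<open>P\<close> and \<open>R\<close> for the products of the \<open>p\<^sub>i\<close> and of the
  \<open>r\<^sub>i\<close>. Two facts carry the theorem.

  \<^item> Spectrum. Write \<open>B = tI - C\<close> with \<open>C \<ge> 0\<close>. Multiplying the rows of \<open>C v = \<lambda> v\<close> around the cycle shows that
    every eigenvalue of \<open>C\<close> satisfies \<open>\<Prod>(\<lambda> - s\<^sub>i) = R\<close> with \<open>s\<^sub>i = t - p\<^sub>i\<close>. If all \<open>p\<^sub>i\<close> and \<open>r\<^sub>i\<close> are
    positive, an eigenvalue of modulus above \<open>t\<close> therefore forces \<open>P < R\<close>; conversely, if \<open>P < R\<close>
    then the intermediate value theorem yields a real eigenvalue above \<open>t\<close>. Deleting an index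
    breaks the cycle, so the principal submatrices of order \<open>n - 1\<close> have only diagonal entries
    \<open>s\<^sub>i\<close> as eigenvalues. Thus, for nonsingular \<open>B\<close>, being an \<open>M\<close>-matrix means \<open>p, r > 0\<close> and \<open>R < P\<close>
    (\<open>M_matrix_cyc_bidiag_iff\<close>), and being an \<open>N\<close>-matrix means \<open>p, r > 0\<close> and \<open>P < R\<close>
    (\<open>N_matrix_cyc_bidiag_iff\<close>).

  \<^item> Inverse. For a matrix whose entries all have the same strict sign, the inverse cyclic property
    says that it is \<open>(x\<^sub>i y\<^sub>j \<kappa>\<^sub>i\<^sub>j)\<close>, where \<open>\<kappa>\<close> is \<open>1\<close> on and above the diagonal and a constant \<open>g\<close>
    below it (\<open>scaled_two_level\<close>). Consecutive rows of \<open>\<kappa>\<close> differ in a single entry, cyclically and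
    up to a factor \<open>g\<close> at the wrap, so for nonzero parameters and \<open>g \<noteq> 1\<close> these matrices are
    the inverses of the invertible cyclic bidiagonal ones with nonzero \<open>p\<close> and \<open>r\<close>, where \<open>g = R / P\<close>.

  In these coordinates \<open>c = g d\<close>, so \<open>d - c = d (1 - g)\<close>; the sign of \<open>d\<close> is that of the entries of
  \<open>A\<close> to the power \<open>n\<close>, and the sign of \<open>1 - g\<close> is that of \<open>P - R\<close> and of the entries of \<open>A\<close>.
  The three parts of the theorem are the cases \<open>e = 1\<close> and \<open>e = - 1\<close> (\<open>n\<close> even, \<open>n\<close> odd) of
  \<open>inverse_positive_cyc_bidiag_iff\<close>, in which \<open>e\<close> is the common sign of the entries.
\<close>

section \<open>Cyclic successors and cyclic chains\<close>

definition cyc_succ :: "nat \<Rightarrow> nat \<Rightarrow> nat" where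
  "cyc_succ n i = (if Suc i = n then 0 else Suc i)"

lemma cyc_succ_less: "i < n \<Longrightarrow> cyc_succ n i < n"
  by (auto simp: cyc_succ_def)

lemma cyc_succ_neq: "2 \<le> n \<Longrightarrow> cyc_succ n i \<noteq> i"
  by (auto simp: cyc_succ_def)

lemma cyc_succ_inj: "cyc_succ n i = cyc_succ n j \<Longrightarrow> i = j"
  by (auto simp: cyc_succ_def split: if_splits)

lemma cyc_succ_surj:
  assumes "i < n"
  obtains k where "k < n" "cyc_succ n k = i"
  using assms that[of "n - 1"] that[of "i - 1"] by (cases i) (auto simp: cyc_succ_def)

text \<open>Walking backwards from \<open>k\<close> reaches \<open>0\<close>, hence \<open>n - 1\<close>, hence every index.\<close>

lemma cyc_induct_backward:
  assumes "P k" "k < n" "i < n"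
    and step: "\<And>i. i < n \<Longrightarrow> P (cyc_succ n i) \<Longrightarrow> P i"
  shows "P i"
proof -
  have down: "P (l - j)" if "P l" "l < n" for l j
  proof (induction j)
    case (Suc j)
    show ?case
    proof (cases "l - j = 0")
      case False
      then have "cyc_succ n (l - Suc j) = l - j"
        using that by (auto simp: cyc_succ_def)
      then show ?thesis using step[of "l - Suc j"] Suc that by simp
    qed (use Suc in simp)
  qed (use that in simp)
  have "P 0" using down[OF assms(1,2), of k] by simp
  then have "P (n - 1)" using step[of "n - 1"] \<open>k < n\<close> by (simp add: cyc_succ_def)
  then show ?thesis using down[of "n - 1" "n - 1 - i"] \<open>i < n\<close> by simp
qed

lemma prod_cyc_succ: "(\<Prod>i<n. f (cyc_succ n i)) = (\<Prod>i<n. f i)"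
proof (rule prod.reindex_bij_betw)
  show "bij_betw (cyc_succ n) {..<n} {..<n}"
  proof (rule bij_betwI')
    fix i assume "i \<in> {..<n}"
    then show "\<exists>k\<in>{..<n}. i = cyc_succ n k" by (metis cyc_succ_surj lessThan_iff)
  qed (auto dest: cyc_succ_inj intro: cyc_succ_less)
qed

text \<open>The recursion \<open>p\<^sub>i v\<^sub>i = r\<^sub>i v\<^sub>i\<^sub>+\<^sub>1\<close> can always be solved along \<open>0, \<dots>, n - 1\<close>; closing the cycle
  costs the factor by which one full turn multiplies \<open>v\<close>. If the two products agree, the factor is
  \<open>1\<close> and \<open>v\<close> solves the cyclic system.\<close>

lemma cyclic_chain_monodromy:
  fixes p r :: "nat \<Rightarrow> 'a::field"
  assumes r: "\<And>i. i < n \<Longrightarrow> r i \<noteq> 0"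
    and p: "\<And>i. i < n \<Longrightarrow> p i \<noteq> 0" and i: "i < n"
  defines "v \<equiv> \<lambda>i. \<Prod>k<i. p k / r k"
  shows "p i * v i =
    r i * v (cyc_succ n i) * (if cyc_succ n i = 0 then (\<Prod>k<n. p k) / (\<Prod>k<n. r k) else 1)"
proof -
  have v: "r i * v (Suc i) = p i * v i"
    using r[OF i] by (simp add: v_def)
  show ?thesis
  proof (cases "Suc i = n")
    case True
    then have "v (Suc i) = (\<Prod>k<n. p k) / (\<Prod>k<n. r k)"
      by (simp add: v_def prod_dividef)
    moreover have "v 0 = 1" by (simp add: v_def)
    ultimately show ?thesis using v True by (simp add: cyc_succ_def)
  next
    case False
    then show ?thesis using v by (simp add: cyc_succ_def)
  qed
qed

text \<open>Multiply all equations: the products of \<open>v\<^sub>i\<close> and of \<open>v\<^sub>\<sigma>\<^sub>(\<^sub>i\<^sub>)\<close> agree and can be cancelled, because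
  one nonzero \<open>v\<^sub>k\<close> makes all of them nonzero.\<close>

lemma cyclic_chain_solvable_imp:
  fixes p r v :: "nat \<Rightarrow> 'a::field"
  assumes r: "\<And>i. i < n \<Longrightarrow> r i \<noteq> 0"
    and eq: "\<And>i. i < n \<Longrightarrow> p i * v i = r i * v (cyc_succ n i)"
    and k: "k < n" "v k \<noteq> 0"
  shows "(\<Prod>i<n. p i) = (\<Prod>i<n. r i)"
proof -
  have v: "v i \<noteq> 0" if "i < n" for i
  proof (rule cyc_induct_backward[where P = "\<lambda>i. v i \<noteq> 0", OF k(2,1) that])
    fix i assume "i < n" "v (cyc_succ n i) \<noteq> 0"
    then show "v i \<noteq> 0" using eq[of i] r[of i] by auto
  qed
  have "(\<Prod>i<n. p i) * (\<Prod>i<n. v i) = (\<Prod>i<n. r i * v (cyc_succ n i))"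
    unfolding prod.distrib[symmetric] by (rule prod.cong) (use eq in auto)
  also have "\<dots> = (\<Prod>i<n. r i) * (\<Prod>i<n. v i)"
    by (simp only: prod.distrib prod_cyc_succ)
  finally show ?thesis using v by simp
qed

section \<open>Eigenvalues of principal submatrices\<close>

lemma bij_betw_pick:
  assumes "I \<subseteq> {..<n}"
  shows "bij_betw (pick I) {..<card I} I"
proof -
  have fin: "finite I" using assms finite_subset by blast
  have "pick I ` {..<card I} = I"
  proof
    show "pick I ` {..<card I} \<subseteq> I" by (auto intro: pick_in_set_le)
    show "I \<subseteq> pick I ` {..<card I}"
    proof
      fix i assume i: "i \<in> I"
      then have "card {a \<in> I. a < i} < card I" using fin by (intro psubset_card_mono) auto
      then show "i \<in> pick I ` {..<card I}" using pick_card_in_set[OF i] by force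
    qed
  qed
  then show ?thesis by (simp add: bij_betw_def eq_card_imp_inj_on)
qed

lemma pick_lessThan: "i < n \<Longrightarrow> pick {..<n} i = i"
  using pick_reduce_set[of i n UNIV] by (simp add: pick_UNIV lessThan_def)

lemma submatrix_carrier:
  assumes "B \<in> carrier_mat n n" "I \<subseteq> {..<n}"
  shows "submatrix B I I \<in> carrier_mat (card I) (card I)"
proof -
  have "{i. i < n \<and> i \<in> I} = I" using assms by auto
  then have "card {i. i < n \<and> i \<in> I} = card I" by (rule arg_cong)
  then show ?thesis using assms(1) by (intro carrier_matI) (simp_all add: dim_submatrix)
qed

lemma submatrix_lessThan:
  assumes B: "B \<in> carrier_mat n n"
  shows "submatrix B {..<n} {..<n} = B"
  using B by (intro eq_matI) (auto simp: submatrix_def pick_lessThan)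

text \<open>Eigenvectors of a principal submatrix are indexed by positions within \<open>I\<close>. Transporting them
  along the enumeration \<open>pick I\<close> lets later arguments use the original indices.\<close>

lemma eigenvalue_submatrix_iff:
  fixes l :: complex
  assumes B: "B \<in> carrier_mat n n" and I: "I \<subseteq> {..<n}"
  shows "eigenvalue (map_mat complex_of_real (submatrix B I I)) l \<longleftrightarrow>
    (\<exists>v. (\<exists>i\<in>I. v i \<noteq> 0) \<and> (\<forall>i\<in>I. (\<Sum>j\<in>I. of_real (B $$ (i, j)) * v j) = l * v i))"
  (is "?L \<longleftrightarrow> ?R")
proof -
  let ?m = "card I"
  let ?C = "map_mat complex_of_real (submatrix B I I)"
  have C: "?C \<in> carrier_mat ?m ?m" using submatrix_carrier[OF B I] by simp
  have bij: "bij_betw (pick I) {..<?m} I" by (rule bij_betw_pick[OF I])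
  have I': "I = pick I ` {..<?m}" using bij by (simp add: bij_betw_def)
  have "{i. i < n \<and> i \<in> I} = I" using I by auto
  then have Cab: "submatrix B I I $$ (a, b) = B $$ (pick I a, pick I b)"
    if "a < ?m" "b < ?m" for a b
    using that B by (simp add: submatrix_def)
  have mult: "(?C *\<^sub>v w) $ a = (\<Sum>j\<in>I. of_real (B $$ (pick I a, j)) * v j)"
    if w: "w \<in> carrier_vec ?m" "\<And>b. b < ?m \<Longrightarrow> w $ b = v (pick I b)" and a: "a < ?m" for w v a
  proof -
    have "(?C *\<^sub>v w) $ a = (\<Sum>b<?m. of_real (B $$ (pick I a, pick I b)) * v (pick I b))"
      using C w a by (simp add: scalar_prod_def atLeast0LessThan Cab)
    also have "\<dots> = (\<Sum>j\<in>I. of_real (B $$ (pick I a, j)) * v j)"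
      by (rule sum.reindex_bij_betw[OF bij])
    finally show ?thesis .
  qed
  show ?thesis
  proof
    assume ?L
    then obtain w where w: "w \<in> carrier_vec ?m" "w \<noteq> 0\<^sub>v ?m" "?C *\<^sub>v w = l \<cdot>\<^sub>v w"
      using C by (auto simp: eigenvalue_def eigenvector_def)
    define v where "v i = w $ (inv_into {..<?m} (pick I) i)" for i
    have v: "w $ b = v (pick I b)" if "b < ?m" for b
      using that bij by (simp add: v_def bij_betw_def)
    have "\<exists>b<?m. w $ b \<noteq> 0" using w(1,2) by (metis carrier_vecD eq_vecI index_zero_vec)
    then have "\<exists>i\<in>I. v i \<noteq> 0" using v I' by force
    moreover have "(\<Sum>j\<in>I. of_real (B $$ (i, j)) * v j) = l * v i" if i: "i \<in> I" for i
    proof -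
      obtain a where a: "a < ?m" "i = pick I a" using i I' by auto
      show ?thesis using mult[OF w(1) v a(1)] w a v by simp
    qed
    ultimately show ?R by blast
  next
    assume ?R
    then obtain v :: "nat \<Rightarrow> complex" where v: "\<exists>i\<in>I. v i \<noteq> 0"
      "\<And>i. i \<in> I \<Longrightarrow> (\<Sum>j\<in>I. of_real (B $$ (i, j)) * v j) = l * v i" by blast
    define w where "w = vec ?m (\<lambda>a. v (pick I a))"
    have w: "w \<in> carrier_vec ?m" "\<And>b. b < ?m \<Longrightarrow> w $ b = v (pick I b)" by (auto simp: w_def)
    obtain i where i: "i \<in> I" "v i \<noteq> 0" using v(1) by blast
    then obtain a where "a < ?m" "i = pick I a" using I' by auto
    then have a: "a < ?m" "v (pick I a) \<noteq> 0" using i by simp_all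
    have "w \<noteq> 0\<^sub>v ?m" using a w(2) by (metis index_zero_vec(1))
    moreover have "?C *\<^sub>v w = l \<cdot>\<^sub>v w"
    proof (rule eq_vecI)
      fix b assume "b < dim_vec (l \<cdot>\<^sub>v w)"
      then have b: "b < ?m" using w by simp
      then have "pick I b \<in> I" using I' by blast
      then show "(?C *\<^sub>v w) $ b = (l \<cdot>\<^sub>v w) $ b" using mult[OF w b] v(2) b w by simp
    qed (use C w in auto)
    ultimately show ?L using C w by (auto simp: eigenvalue_def eigenvector_def)
  qed
qed

lemma rho_attained:
  assumes "C \<in> carrier_mat m m" "0 < m"
  obtains l where "eigenvalue (map_mat complex_of_real C) l" "norm l = rho C"
proof -
  have "rho C \<in> norm ` spectrum (map_mat complex_of_real C)"
    unfolding rho_def using assms by (intro spectral_radius_mem_max(1)[of _ m]) auto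
  then show ?thesis using that by (auto simp: spectrum_def)
qed

lemma norm_eigenvalue_le_rho:
  assumes "C \<in> carrier_mat m m" "0 < m" "eigenvalue (map_mat complex_of_real C) l"
  shows "norm l \<le> rho C"
  unfolding rho_def using assms
  by (intro spectral_radius_mem_max(2)[of _ m]) (auto simp: spectrum_def)

section \<open>Spectrum of a cyclic bidiagonal matrix\<close>

text \<open>With the minus sign, the \<open>Z\<close>-matrices of this shape are those with \<open>r \<ge> 0\<close>. The two terms are
  subtracted rather than placed by case distinction, so that row sums split whether or not
  \<open>i\<close> and its successor coincide.\<close>

definition cyc_bidiag :: "nat \<Rightarrow> (nat \<Rightarrow> real) \<Rightarrow> (nat \<Rightarrow> real) \<Rightarrow> real mat" where
  "cyc_bidiag n p r = mat n n
     (\<lambda>(i, j). (if j = i then p i else 0) - (if j = cyc_succ n i then r i else 0))"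

lemma cyc_bidiag_carrier [simp]: "cyc_bidiag n p r \<in> carrier_mat n n"
  by (simp add: cyc_bidiag_def)

lemma cyc_bidiag_dim [simp]:
  "dim_row (cyc_bidiag n p r) = n" "dim_col (cyc_bidiag n p r) = n"
  by (simp_all add: cyc_bidiag_def)

lemma eigenvalue_submatrix_cyc_bidiag_iff:
  fixes l :: complex
  assumes I: "I \<subseteq> {..<n}"
  shows "eigenvalue (map_mat complex_of_real (submatrix (cyc_bidiag n s (\<lambda>i. - r i)) I I)) l \<longleftrightarrow>
    (\<exists>v. (\<exists>i\<in>I. v i \<noteq> 0) \<and>
      (\<forall>i\<in>I. (l - s i) * v i = (if cyc_succ n i \<in> I then r i * v (cyc_succ n i) else 0)))"
proof -
  have fin: "finite I" using I finite_subset by blast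
  have row: "(\<Sum>j\<in>I. of_real (cyc_bidiag n s (\<lambda>i. - r i) $$ (i, j)) * v j) =
      s i * v i + (if cyc_succ n i \<in> I then r i * v (cyc_succ n i) else 0)"
    if i: "i \<in> I" for i and v :: "nat \<Rightarrow> complex"
  proof -
    have "(\<Sum>j\<in>I. of_real (cyc_bidiag n s (\<lambda>i. - r i) $$ (i, j)) * v j) =
      (\<Sum>j\<in>I. (if j = i then s i * v i else 0) +
        (if j = cyc_succ n i then r i * v (cyc_succ n i) else 0))"
      using I i by (intro sum.cong) (auto simp: cyc_bidiag_def subset_iff algebra_simps)
    then show ?thesis using fin i by (simp add: sum.distrib)
  qed
  have row_iff: "(\<Sum>j\<in>I. of_real (cyc_bidiag n s (\<lambda>i. - r i) $$ (i, j)) * v j) = l * v i \<longleftrightarrow>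
      (l - s i) * v i = (if cyc_succ n i \<in> I then r i * v (cyc_succ n i) else 0)"
    if "i \<in> I" for i and v :: "nat \<Rightarrow> complex"
    unfolding row[OF that] left_diff_distrib diff_eq_eq by (auto simp: add.commute)
  show ?thesis
    unfolding eigenvalue_submatrix_iff[OF cyc_bidiag_carrier I]
    by (intro ex_cong1 conj_cong ball_cong refl row_iff)
qed

lemma eigenvalue_cyc_bidiag_iff:
  fixes l :: complex
  shows "eigenvalue (map_mat complex_of_real (cyc_bidiag n s (\<lambda>i. - r i))) l \<longleftrightarrow>
    (\<exists>v. (\<exists>i<n. v i \<noteq> 0) \<and> (\<forall>i<n. (l - s i) * v i = r i * v (cyc_succ n i)))"
  using eigenvalue_submatrix_cyc_bidiag_iff[of "{..<n}" n s r l]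
  by (simp add: submatrix_lessThan cyc_succ_less Bex_def Ball_def)

lemma eigenvalue_cyc_bidiag_imp_prod:
  fixes l :: complex
  assumes r: "\<And>i. i < n \<Longrightarrow> 0 < r i"
    and l: "eigenvalue (map_mat complex_of_real (cyc_bidiag n s (\<lambda>i. - r i))) l"
  shows "(\<Prod>i<n. l - s i) = (\<Prod>i<n. r i)"
proof -
  obtain v :: "nat \<Rightarrow> complex" where v0: "\<exists>i<n. v i \<noteq> 0"
    and v: "\<forall>i<n. (l - s i) * v i = r i * v (cyc_succ n i)"
    using l unfolding eigenvalue_cyc_bidiag_iff by blast
  from v0 obtain k where k: "k < n" "v k \<noteq> 0" by blast
  have "complex_of_real (r i) \<noteq> 0" if "i < n" for i using r[OF that] by simp
  then have "(\<Prod>i<n. l - s i) = (\<Prod>i<n. complex_of_real (r i))"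
    by (rule cyclic_chain_solvable_imp[OF _ v[rule_format] k])
  then show ?thesis by simp
qed

text \<open>The intermediate value theorem for \<open>\<Prod>(x - s\<^sub>i)\<close>, which starts below \<open>R = \<Prod>r\<^sub>i\<close> at \<open>m\<close> and
  exceeds it later, gives \<open>x > m\<close> with equality; the factor for a full turn is then \<open>1\<close> and the
  chain solution is an eigenvector.\<close>

lemma real_eigenvalue_cyc_bidiag:
  assumes n: "0 < n" and r: "\<And>i. i < n \<Longrightarrow> 0 < r i"
    and m: "\<And>i. i < n \<Longrightarrow> s i \<le> m" and less: "(\<Prod>i<n. m - s i) < (\<Prod>i<n. r i)"
  obtains x where "m < x" "eigenvalue (map_mat complex_of_real (cyc_bidiag n s (\<lambda>i. - r i))) (of_real x)"
proof -
  let ?R = "\<Prod>i<n. r i"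
  \<comment> \<open>At this point every factor \<open>x - s\<^sub>i\<close> is at least \<open>1 + R\<close>, so the product exceeds \<open>R\<close>.\<close>
  let ?M = "m + 1 + ?R"
  have R: "0 < ?R" using r by (intro prod_pos) auto
  have "?R \<le> (1 + ?R) ^ 1" by simp
  also have "\<dots> \<le> (1 + ?R) ^ n" using R n by (intro power_increasing) auto
  also have "\<dots> = (\<Prod>i<n. 1 + ?R)" by simp
  also have "\<dots> \<le> (\<Prod>i<n. ?M - s i)" using R m by (intro prod_mono) (auto simp: algebra_simps)
  finally have "\<exists>x\<ge>m. x \<le> ?M \<and> (\<Prod>i<n. x - s i) = ?R"
    using less R by (intro IVT'[of "\<lambda>x. \<Prod>i<n. x - s i" m _ ?M]) (auto intro!: continuous_intros)
  then obtain x where x: "m \<le> x" "(\<Prod>i<n. x - s i) = ?R" by blast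
  then have mx: "m < x" using less by (cases "m = x") auto
  define v where "v i = (\<Prod>k<i. (x - s k) / r k)" for i
  have chain: "(x - s i) * v i = r i * v (cyc_succ n i)" if i: "i < n" for i
  proof -
    have "r k \<noteq> 0" "x - s k \<noteq> 0" if "k < n" for k using r[OF that] m[OF that] mx by auto
    from cyclic_chain_monodromy[of n r "\<lambda>i. x - s i" i, OF this i]
    have "(x - s i) * v i =
        r i * v (cyc_succ n i) * (if cyc_succ n i = 0 then (\<Prod>i<n. x - s i) / ?R else 1)"
      unfolding v_def .
    moreover have "(\<Prod>i<n. x - s i) / ?R = 1"
      unfolding x(2) by (rule divide_self) (use R in linarith)
    ultimately show ?thesis by (simp only: if_cancel mult_1_right)
  qed
  then have "(of_real x - s i) * of_real (v i) = of_real (r i) * complex_of_real (v (cyc_succ n i))"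
    if "i < n" for i
    using arg_cong[OF chain[OF that], of complex_of_real] by simp
  moreover have "v 0 \<noteq> 0" by (simp add: v_def)
  ultimately have "eigenvalue (map_mat complex_of_real (cyc_bidiag n s (\<lambda>i. - r i))) (of_real x)"
    unfolding eigenvalue_cyc_bidiag_iff using n
    by (intro exI[of _ "\<lambda>i. of_real (v i)"]) auto
  then show ?thesis using that mx by blast
qed

lemma prod_less_prod_of_pos:
  fixes p q :: "nat \<Rightarrow> real"
  assumes "0 < n" "\<And>i. i < n \<Longrightarrow> 0 < p i" "\<And>i. i < n \<Longrightarrow> p i < q i"
  shows "(\<Prod>i<n. p i) < (\<Prod>i<n. q i)"
proof -
  have "0 < q i" if "i < n" for i using assms(2,3)[OF that] by linarith
  then show ?thesis using assms by (intro prod_mono_strict) (auto intro: less_imp_le)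
qed

text \<open>Beyond \<open>t\<close> every factor of \<open>\<Prod>\<bar>\<lambda> - s\<^sub>i\<bar> = R\<close> is larger than \<open>t - s\<^sub>i\<close>, since \<open>\<bar>\<lambda> - s\<^sub>i\<bar> \<ge> \<bar>\<lambda>\<bar> - s\<^sub>i\<close>.\<close>

lemma prod_less_if_eigenvalue_beyond:
  fixes l :: complex
  assumes n: "0 < n" and r: "\<And>i. i < n \<Longrightarrow> 0 < r i"
    and s: "\<And>i. i < n \<Longrightarrow> 0 \<le> s i \<and> s i < t"
    and l: "eigenvalue (map_mat complex_of_real (cyc_bidiag n s (\<lambda>i. - r i))) l" and tl: "t < norm l"
  shows "(\<Prod>i<n. t - s i) < (\<Prod>i<n. r i)"
proof -
  have "(\<Prod>i<n. t - s i) < (\<Prod>i<n. norm (l - s i))"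
  proof (rule prod_less_prod_of_pos[OF n])
    fix i assume i: "i < n"
    then show "0 < t - s i" using s by simp
    have "norm l - norm (complex_of_real (s i)) \<le> norm (l - s i)" by (rule norm_triangle_ineq2)
    then show "t - s i < norm (l - s i)" using s[OF i] tl by simp
  qed
  also have "\<dots> = norm (complex_of_real (\<Prod>i<n. r i))"
    using eigenvalue_cyc_bidiag_imp_prod[OF r l] by (simp add: prod_norm)
  also have "\<dots> = (\<Prod>i<n. r i)"
  proof -
    have "0 \<le> (\<Prod>i<n. r i)" using r by (intro prod_nonneg) (auto intro: less_imp_le)
    then show ?thesis by (simp only: norm_of_real abs_of_nonneg)
  qed
  finally show ?thesis .
qed

section \<open>M-matrices and N-matrices among the cyclic bidiagonal matrices\<close>

text \<open>Shifting by \<open>tI\<close> stays within the cyclic bidiagonal matrices, so the spectral results apply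
  to the nonnegative part of any representation. For \<open>n \<ge> 2\<close> the entries \<open>r\<^sub>i\<close> lie off the diagonal
  and can be read off from it.\<close>

lemma Z_rep_cyc_bidiag_iff:
  assumes n: "2 \<le> n"
  shows "Z_rep n (cyc_bidiag n p r) t B \<longleftrightarrow>
    B = cyc_bidiag n (\<lambda>i. t - p i) (\<lambda>i. - r i) \<and> (\<forall>i<n. p i \<le> t \<and> 0 \<le> r i)"
proof -
  have eq: "cyc_bidiag n p r = t \<cdot>\<^sub>m 1\<^sub>m n - cyc_bidiag n (\<lambda>i. t - p i) (\<lambda>i. - r i)"
    by (rule eq_matI) (auto simp: cyc_bidiag_def)
  have uniq: "B = cyc_bidiag n (\<lambda>i. t - p i) (\<lambda>i. - r i)"
    if "B \<in> carrier_mat n n" "cyc_bidiag n p r = t \<cdot>\<^sub>m 1\<^sub>m n - B"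
  proof (rule eq_matI)
    fix i j assume "i < dim_row (cyc_bidiag n (\<lambda>i. t - p i) (\<lambda>i. - r i))"
      "j < dim_col (cyc_bidiag n (\<lambda>i. t - p i) (\<lambda>i. - r i))"
    then have ij: "i < n" "j < n" by (auto simp: cyc_bidiag_def)
    have "cyc_bidiag n p r $$ (i, j) = (t \<cdot>\<^sub>m 1\<^sub>m n - B) $$ (i, j)" using that by simp
    then show "B $$ (i, j) = cyc_bidiag n (\<lambda>i. t - p i) (\<lambda>i. - r i) $$ (i, j)"
      using ij that(1) by (auto simp: cyc_bidiag_def split: if_splits)
  qed (use that(1) in simp_all)
  have "nonneg_mat (cyc_bidiag n (\<lambda>i. t - p i) (\<lambda>i. - r i)) \<longleftrightarrow> (\<forall>i<n. p i \<le> t \<and> 0 \<le> r i)"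
  proof
    assume N: "nonneg_mat (cyc_bidiag n (\<lambda>i. t - p i) (\<lambda>i. - r i))"
    show "\<forall>i<n. p i \<le> t \<and> 0 \<le> r i"
    proof (intro allI impI)
      fix i assume i: "i < n"
      show "p i \<le> t \<and> 0 \<le> r i"
        using N[unfolded nonneg_mat_def, rule_format, of i i]
          N[unfolded nonneg_mat_def, rule_format, of i "cyc_succ n i"]
          i cyc_succ_less[OF i] cyc_succ_neq[OF n, of i]
        by (simp add: cyc_bidiag_def)
    qed
  qed (auto simp: nonneg_mat_def cyc_bidiag_def)
  then show ?thesis using eq uniq unfolding Z_rep_def by auto
qed

text \<open>Equal products, excluded here, would make the matrix singular; see
  \<open>invertible_cyc_bidiag_imp_prod_neq\<close> below.\<close>

lemma M_matrix_cyc_bidiag_iff: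
  assumes n: "2 \<le> n" and r: "\<And>i. i < n \<Longrightarrow> r i \<noteq> 0"
    and ne: "(\<Prod>i<n. p i) \<noteq> (\<Prod>i<n. r i)"
  shows "M_matrix n (cyc_bidiag n p r) \<longleftrightarrow>
    (\<forall>i<n. 0 < p i \<and> 0 < r i) \<and> (\<Prod>i<n. r i) < (\<Prod>i<n. p i)"
proof
  have n0: "0 < n" using n by simp
  {
    assume "M_matrix n (cyc_bidiag n p r)"
    then obtain t where t: "rho (cyc_bidiag n (\<lambda>i. t - p i) (\<lambda>i. - r i)) \<le> t"
      and pt: "\<And>i. i < n \<Longrightarrow> p i \<le> t" and r0: "\<And>i. i < n \<Longrightarrow> 0 \<le> r i"
      unfolding M_matrix_def Z_rep_cyc_bidiag_iff[OF n] by blast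
    have rp: "0 < r i" if "i < n" for i using r[OF that] r0[OF that] by simp
    have less_t: "m < t"
      if ge: "\<And>i. i < n \<Longrightarrow> t - p i \<le> m" and less: "(\<Prod>i<n. m - (t - p i)) < (\<Prod>i<n. r i)" for m
    proof -
      obtain x where x: "m < x" "eigenvalue (map_mat complex_of_real
          (cyc_bidiag n (\<lambda>i. t - p i) (\<lambda>i. - r i))) (of_real x)"
        using real_eigenvalue_cyc_bidiag[of n r "\<lambda>i. t - p i" m, OF n0 rp ge less] by blast
      have "norm (complex_of_real x) \<le> t"
        using norm_eigenvalue_le_rho[OF cyc_bidiag_carrier n0 x(2)] t by linarith
      then show ?thesis using x(1) by simp
    qed
    \<comment> \<open>At the largest diagonal entry \<open>m\<close> the product vanishes, so there is an eigenvalue beyond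
      \<open>m\<close>. Hence \<open>m < t\<close>, which is the positivity of all \<open>p\<^sub>i\<close>.\<close>
    define m where "m = Max ((\<lambda>i. t - p i) ` {..<n})"
    have m_ge: "t - p i \<le> m" if "i < n" for i
      unfolding m_def using that by (intro Max_ge) auto
    have "m \<in> (\<lambda>i. t - p i) ` {..<n}"
      unfolding m_def using n0 by (intro Max_in) auto
    then have "(\<Prod>i<n. m - (t - p i)) = 0" by auto
    moreover have "0 < (\<Prod>i<n. r i)" using rp by (intro prod_pos) auto
    ultimately have "m < t" using less_t[OF m_ge] by presburger
    then have pp: "0 < p i" if "i < n" for i using m_ge[OF that] by linarith
    have "\<not> (\<Prod>i<n. p i) < (\<Prod>i<n. r i)"
      using less_t[of t] pp by force
    then show "(\<forall>i<n. 0 < p i \<and> 0 < r i) \<and> (\<Prod>i<n. r i) < (\<Prod>i<n. p i)"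
      using ne pp rp by auto
  next
    assume R: "(\<forall>i<n. 0 < p i \<and> 0 < r i) \<and> (\<Prod>i<n. r i) < (\<Prod>i<n. p i)"
    define t where "t = (\<Sum>i<n. p i)"
    let ?B = "cyc_bidiag n (\<lambda>i. t - p i) (\<lambda>i. - r i)"
    have pt: "p i \<le> t" if "i < n" for i
      unfolding t_def using R that by (intro member_le_sum) (auto intro: less_imp_le)
    have "rho ?B \<le> t"
    proof (rule ccontr)
      assume "\<not> rho ?B \<le> t"
      moreover obtain l where l: "eigenvalue (map_mat complex_of_real ?B) l" "norm l = rho ?B"
        using rho_attained[OF cyc_bidiag_carrier n0] .
      ultimately have "(\<Prod>i<n. t - (t - p i)) < (\<Prod>i<n. r i)"
        using R pt by (intro prod_less_if_eigenvalue_beyond[OF n0 _ _ l(1)]) auto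
      then show False using R by simp
    qed
    then show "M_matrix n (cyc_bidiag n p r)"
      unfolding M_matrix_def Z_rep_cyc_bidiag_iff[OF n] using R pt by (auto intro: less_imp_le)
  }
qed

lemma rho_sub_set_finite: "finite {rho (submatrix B I I) | I. I \<subseteq> {..<dim_row B} \<and> card I = m}"
proof (rule finite_subset)
  show "{rho (submatrix B I I) | I. I \<subseteq> {..<dim_row B} \<and> card I = m}
    \<subseteq> (\<lambda>I. rho (submatrix B I I)) ` Pow {..<dim_row B}" by auto
qed simp

lemma rho_le_rho_sub:
  assumes "B \<in> carrier_mat n n" "I \<subseteq> {..<n}" "card I = m"
  shows "rho (submatrix B I I) \<le> rho_sub m B"
  unfolding rho_sub_def using assms by (intro Max_ge rho_sub_set_finite) auto

lemma rho_sub_attained: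
  assumes "B \<in> carrier_mat n n" "m \<le> n"
  obtains I where "I \<subseteq> {..<n}" "card I = m" "rho_sub m B = rho (submatrix B I I)"
proof -
  have "{..<m} \<subseteq> {..<dim_row B}" "card {..<m} = m" using assms by auto
  then have "rho_sub m B \<in> {rho (submatrix B I I) | I. I \<subseteq> {..<dim_row B} \<and> card I = m}"
    unfolding rho_sub_def by (intro Max_in rho_sub_set_finite) blast
  then show ?thesis using that assms by auto
qed

text \<open>Column \<open>i\<close> has its only off-diagonal entry in the row of the predecessor of \<open>i\<close>. Deleting that
  index leaves \<open>s\<^sub>i\<close> alone in the column, so the unit vector at \<open>i\<close> is an eigenvector for \<open>s\<^sub>i\<close>.\<close>

lemma diagonal_le_rho_sub_cyc_bidiag:
  assumes n: "2 \<le> n" and i: "i < n" and s: "0 \<le> s i"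
  shows "s i \<le> rho_sub (n - 1) (cyc_bidiag n s (\<lambda>i. - r i))"
proof -
  obtain k where k: "k < n" "cyc_succ n k = i" using cyc_succ_surj[OF i] .
  then have ik: "i \<noteq> k" using cyc_succ_neq[OF n] by metis
  define I where "I = {..<n} - {k}"
  have I: "I \<subseteq> {..<n}" "card I = n - 1" "i \<in> I" using i k ik by (auto simp: I_def)
  have no_pred: "cyc_succ n a \<noteq> i" if "a \<in> I" for a
    using that k cyc_succ_inj by (auto simp: I_def)
  have "eigenvalue (map_mat complex_of_real (submatrix (cyc_bidiag n s (\<lambda>i. - r i)) I I)) (of_real (s i))"
    unfolding eigenvalue_submatrix_cyc_bidiag_iff[OF I(1)]
    using no_pred I(3) by (intro exI[of _ "\<lambda>j. if j = i then 1 else 0"]) auto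
  then have "norm (complex_of_real (s i)) \<le> rho (submatrix (cyc_bidiag n s (\<lambda>i. - r i)) I I)"
    using submatrix_carrier[OF cyc_bidiag_carrier I(1)] I(2) n
    by (intro norm_eigenvalue_le_rho[of _ "n - 1"]) auto
  also have "\<dots> \<le> rho_sub (n - 1) (cyc_bidiag n s (\<lambda>i. - r i))"
    by (rule rho_le_rho_sub[OF cyc_bidiag_carrier I(1,2)])
  finally show ?thesis using s by simp
qed

text \<open>A principal submatrix of order \<open>n - 1\<close> misses an index \<open>k\<close>, and extending an eigenvector by \<open>0\<close>
  at \<open>k\<close> breaks the cycle: for \<open>\<lambda>\<close> different from all \<open>s\<^sub>i\<close>, the zero at \<open>k\<close> propagates backwards to
  the whole vector. So every eigenvalue is one of the \<open>s\<^sub>i\<close>.\<close>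

lemma rho_sub_cyc_bidiag_less:
  assumes n: "2 \<le> n" and s: "\<And>i. i < n \<Longrightarrow> 0 \<le> s i \<and> s i < t"
  shows "rho_sub (n - 1) (cyc_bidiag n s (\<lambda>i. - r i)) < t"
proof -
  let ?B = "cyc_bidiag n s (\<lambda>i. - r i)"
  obtain I where I: "I \<subseteq> {..<n}" "card I = n - 1" "rho_sub (n - 1) ?B = rho (submatrix ?B I I)"
    using rho_sub_attained[OF cyc_bidiag_carrier diff_le_self] .
  have "submatrix ?B I I \<in> carrier_mat (n - 1) (n - 1)"
    using submatrix_carrier[OF cyc_bidiag_carrier I(1)] I(2) by simp
  then obtain l where l: "eigenvalue (map_mat complex_of_real (submatrix ?B I I)) l"
    "norm l = rho (submatrix ?B I I)"
    using rho_attained[of _ "n - 1"] n by auto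
  then obtain v :: "nat \<Rightarrow> complex" where v: "\<exists>i\<in>I. v i \<noteq> 0"
    "\<forall>i\<in>I. (l - s i) * v i = (if cyc_succ n i \<in> I then r i * v (cyc_succ n i) else 0)"
    unfolding eigenvalue_submatrix_cyc_bidiag_iff[OF I(1)] by blast
  obtain k where k: "k < n" "k \<notin> I"
  proof -
    have "I \<noteq> {..<n}" using I(2) n by auto
    then show ?thesis using I(1) that by blast
  qed
  have "\<exists>i\<in>I. l = s i"
  proof (rule ccontr)
    assume no: "\<not> (\<exists>i\<in>I. l = s i)"
    have "i \<in> I \<longrightarrow> v i = 0" if "i < n" for i
    proof (rule cyc_induct_backward[OF _ k(1) that])
      fix i assume "i < n" "cyc_succ n i \<in> I \<longrightarrow> v (cyc_succ n i) = 0"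
      then show "i \<in> I \<longrightarrow> v i = 0" using bspec[OF v(2), of i] no by (auto split: if_splits)
    qed (use k in simp)
    then show False using v(1) I(1) by blast
  qed
  then obtain i where "i \<in> I" "l = s i" by blast
  then have "norm l < t" using s[of i] I(1) by auto
  then show ?thesis using l(2) I(3) by simp
qed

lemma N_matrix_cyc_bidiag_iff:
  assumes n: "2 \<le> n" and r: "\<And>i. i < n \<Longrightarrow> r i \<noteq> 0"
  shows "N_matrix n (cyc_bidiag n p r) \<longleftrightarrow>
    (\<forall>i<n. 0 < p i \<and> 0 < r i) \<and> (\<Prod>i<n. p i) < (\<Prod>i<n. r i)"
proof
  have n0: "0 < n" using n by simp
  {
    assume "N_matrix n (cyc_bidiag n p r)"
    then obtain t where sub: "rho_sub (n - 1) (cyc_bidiag n (\<lambda>i. t - p i) (\<lambda>i. - r i)) < t"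
      and full: "t < rho (cyc_bidiag n (\<lambda>i. t - p i) (\<lambda>i. - r i))"
      and pt: "\<And>i. i < n \<Longrightarrow> p i \<le> t" and r0: "\<And>i. i < n \<Longrightarrow> 0 \<le> r i"
      unfolding N_matrix_def Z_rep_cyc_bidiag_iff[OF n] by blast
    have rp: "0 < r i" if "i < n" for i using r[OF that] r0[OF that] by simp
    have pp: "0 < p i" if "i < n" for i
      using diagonal_le_rho_sub_cyc_bidiag[of n i "\<lambda>i. t - p i" r, OF n that] pt[OF that] sub
      by simp
    obtain l where l: "eigenvalue (map_mat complex_of_real
        (cyc_bidiag n (\<lambda>i. t - p i) (\<lambda>i. - r i))) l"
      "norm l = rho (cyc_bidiag n (\<lambda>i. t - p i) (\<lambda>i. - r i))"
      using rho_attained[OF cyc_bidiag_carrier n0] .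
    then have "(\<Prod>i<n. t - (t - p i)) < (\<Prod>i<n. r i)"
      using full rp pp pt by (intro prod_less_if_eigenvalue_beyond[OF n0 _ _ l(1)]) auto
    then show "(\<forall>i<n. 0 < p i \<and> 0 < r i) \<and> (\<Prod>i<n. p i) < (\<Prod>i<n. r i)"
      using pp rp by simp
  next
    assume R: "(\<forall>i<n. 0 < p i \<and> 0 < r i) \<and> (\<Prod>i<n. p i) < (\<Prod>i<n. r i)"
    define t where "t = (\<Sum>i<n. p i)"
    let ?B = "cyc_bidiag n (\<lambda>i. t - p i) (\<lambda>i. - r i)"
    have pt: "p i \<le> t" if "i < n" for i
      unfolding t_def using R that by (intro member_le_sum) (auto intro: less_imp_le)
    have sub: "rho_sub (n - 1) ?B < t"
      using R pt by (intro rho_sub_cyc_bidiag_less[OF n]) auto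
    obtain x where x: "t < x" "eigenvalue (map_mat complex_of_real ?B) (of_real x)"
    proof (rule real_eigenvalue_cyc_bidiag[of n r "\<lambda>i. t - p i" t, OF n0])
      show "(\<Prod>i<n. t - (t - p i)) < (\<Prod>i<n. r i)" using R by simp
    qed (use R in \<open>auto intro: less_imp_le\<close>)
    have "norm (complex_of_real x) \<le> rho ?B"
      by (rule norm_eigenvalue_le_rho[OF cyc_bidiag_carrier n0 x(2)])
    then have "t < rho ?B" using x(1) by simp
    then show "N_matrix n (cyc_bidiag n p r)"
      unfolding N_matrix_def Z_rep_cyc_bidiag_iff[OF n] using R pt sub n by (auto intro: less_imp_le)
  }
qed

lemma bdsw_iff_cyc_bidiag:
  assumes n: "2 \<le> n"
  shows "bdsw n X \<longleftrightarrow> (\<exists>p r. X = cyc_bidiag n p r \<and> (\<forall>i<n. p i \<noteq> 0 \<and> r i \<noteq> 0))"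
proof -
  have succ: "j = i + 1 \<or> (i = n - 1 \<and> j = 0) \<longleftrightarrow> j = cyc_succ n i" if "i < n" "j < n" for i j
    using that by (auto simp: cyc_succ_def)
  have nz: "i \<noteq> cyc_succ n i" for i using cyc_succ_neq[OF n, of i] by simp
  show ?thesis
  proof
    assume X: "bdsw n X"
    then have supp: "X $$ (i, j) \<noteq> 0 \<longleftrightarrow> j = i \<or> j = cyc_succ n i" if "i < n" "j < n" for i j
      using that succ[OF that] unfolding bdsw_def by blast
    have C: "X \<in> carrier_mat n n" using X by (simp add: bdsw_def)
    have "X = cyc_bidiag n (\<lambda>i. X $$ (i, i)) (\<lambda>i. - X $$ (i, cyc_succ n i))"
      using C supp nz by (intro eq_matI) (auto simp: cyc_bidiag_def)
    then show "\<exists>p r. X = cyc_bidiag n p r \<and> (\<forall>i<n. p i \<noteq> 0 \<and> r i \<noteq> 0)"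
      using supp cyc_succ_less
      by (intro exI[of _ "\<lambda>i. X $$ (i, i)"] exI[of _ "\<lambda>i. - X $$ (i, cyc_succ n i)"]) auto
  next
    assume "\<exists>p r. X = cyc_bidiag n p r \<and> (\<forall>i<n. p i \<noteq> 0 \<and> r i \<noteq> 0)"
    then obtain p r where X: "X = cyc_bidiag n p r" and pr: "\<And>i. i < n \<Longrightarrow> p i \<noteq> 0 \<and> r i \<noteq> 0"
      by blast
    have "X $$ (i, j) \<noteq> 0 \<longleftrightarrow> j = i \<or> j = i + 1 \<or> (i = n - 1 \<and> j = 0)" if "i < n" "j < n" for i j
    proof -
      have "X $$ (i, j) \<noteq> 0 \<longleftrightarrow> j = i \<or> j = cyc_succ n i"
        using that pr[of i] nz[of i] by (cases "j = i"; cases "j = cyc_succ n i") (auto simp: X cyc_bidiag_def)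
      then show ?thesis unfolding succ[OF that] .
    qed
    then show "bdsw n X" unfolding bdsw_def X by simp
  qed
qed

section \<open>Inverses of cyclic bidiagonal matrices\<close>

definition scaled_two_level :: "nat \<Rightarrow> real \<Rightarrow> (nat \<Rightarrow> real) \<Rightarrow> (nat \<Rightarrow> real) \<Rightarrow> real mat" where
  "scaled_two_level n g x y = mat n n (\<lambda>(i, j). x i * y j * (if i \<le> j then 1 else g))"

lemma scaled_two_level_carrier [simp]: "scaled_two_level n g x y \<in> carrier_mat n n"
  by (simp add: scaled_two_level_def)

lemma cyc_bidiag_mult_index:
  assumes F: "F \<in> carrier_mat n n" and ij: "i < n" "j < n"
  shows "(cyc_bidiag n p r * F) $$ (i, j) = p i * F $$ (i, j) - r i * F $$ (cyc_succ n i, j)"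
proof -
  have "(cyc_bidiag n p r * F) $$ (i, j) =
    (\<Sum>k<n. ((if k = i then p i else 0) - (if k = cyc_succ n i then r i else 0)) * F $$ (k, j))"
    using F ij by (simp add: cyc_bidiag_def scalar_prod_def atLeast0LessThan)
  also have "\<dots> = (\<Sum>k<n. (if k = i then p i * F $$ (i, j) else 0)
      - (if k = cyc_succ n i then r i * F $$ (cyc_succ n i, j) else 0))"
    by (intro sum.cong) (auto simp: algebra_simps)
  finally show ?thesis using ij cyc_succ_less[of i n] by (simp add: sum_subtractf)
qed

text \<open>The hypothesis on \<open>r\<close> makes row \<open>i\<close> of the product equal to \<open>p\<^sub>i x\<^sub>i\<close> times the difference of two
  cyclically consecutive rows of the two-level matrix, the wrapped row \<open>0\<close> being scaled by \<open>g\<close>.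
  These rows differ only at the diagonal position, by \<open>1 - g\<close>.\<close>

lemma cyc_bidiag_mult_scaled_two_level:
  assumes p: "\<And>i. i < n \<Longrightarrow> p i * x i * y i * (1 - g) = 1"
    and r: "\<And>i. i < n \<Longrightarrow> p i * x i = r i * x (cyc_succ n i) * (if cyc_succ n i = 0 then 1 / g else 1)"
    and g: "g \<noteq> 0"
  shows "cyc_bidiag n p r * scaled_two_level n g x y = 1\<^sub>m n"
proof (rule eq_matI)
  fix i j assume "i < dim_row (1\<^sub>m n :: real mat)" "j < dim_col (1\<^sub>m n :: real mat)"
  then have ij: "i < n" "j < n" by auto
  let ?k = "cyc_succ n i"
  have "(cyc_bidiag n p r * scaled_two_level n g x y) $$ (i, j) =
    p i * x i * y j * (if i \<le> j then 1 else g) - r i * x ?k * y j * (if ?k \<le> j then 1 else g)"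
    using ij cyc_succ_less[of i n] by (simp add: cyc_bidiag_mult_index) (simp add: scaled_two_level_def)
  also have "r i * x ?k = p i * x i * (if ?k = 0 then g else 1)" using r[OF ij(1)] g by simp
  also have "p i * x i * y j * (if i \<le> j then 1 else g)
      - p i * x i * (if ?k = 0 then g else 1) * y j * (if ?k \<le> j then 1 else g)
      = (if i = j then p i * x i * y i * (1 - g) else 0)"
    using ij by (auto simp: cyc_succ_def algebra_simps)
  finally show "(cyc_bidiag n p r * scaled_two_level n g x y) $$ (i, j) = 1\<^sub>m n $$ (i, j)"
    using ij p by simp
qed (auto simp: cyc_bidiag_def scaled_two_level_def)

lemma inverse_cyclic_scaled_two_level:
  assumes "\<And>i. i < n \<Longrightarrow> x i \<noteq> 0" "\<And>i. i < n \<Longrightarrow> y i \<noteq> 0"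
  shows "inverse_cyclic n (scaled_two_level n g x y)"
  using assms by (auto simp: inverse_cyclic_def scaled_two_level_def)

text \<open>Going from \<open>i\<close> to \<open>j\<close> around the cycle, the inverse cyclic property factors each entry through
  the intermediate indices. For \<open>i \<le> j\<close> the entries at \<open>(0, j)\<close> and \<open>(0, n - 1)\<close> both factor through
  \<open>i\<close>, and the common factors cancel in \<open>x\<^sub>i y\<^sub>j\<close>; for \<open>j < i\<close> the path passes through \<open>n - 1\<close> and \<open>0\<close>.
  Taking \<open>x\<close> from the last column and \<open>y\<close> from the normalised first row puts the common sign \<open>e\<close>
  into \<open>x\<close> alone, so that \<open>y\<close> and \<open>g\<close> are positive.\<close>

lemma inverse_cyclic_imp_scaled_two_level:
  fixes e :: real
  assumes n: "0 < n" and A: "inverse_cyclic n A"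
    and sgn: "\<And>i j. i < n \<Longrightarrow> j < n \<Longrightarrow> 0 < e * A $$ (i, j)"
  obtains g x y where "A = scaled_two_level n g x y" "0 < g"
    "\<And>i. i < n \<Longrightarrow> 0 < e * x i" "\<And>j. j < n \<Longrightarrow> 0 < y j"
proof -
  define x where "x i = A $$ (i, n - 1)" for i
  define y where "y j = A $$ (0, j) / A $$ (0, n - 1)" for j
  define g where "g = A $$ (n - 1, 0) * A $$ (0, n - 1) / (A $$ (0, 0) * A $$ (n - 1, n - 1))"
  have nz: "A $$ (i, j) \<noteq> 0" if "i < n" "j < n" for i j using sgn[OF that] by auto
  have pos_mult: "0 < A $$ (i, j) * A $$ (k, l)" if "i < n" "j < n" "k < n" "l < n" for i j k l
    using mult_pos_pos[OF sgn[OF that(1,2)] sgn[OF that(3,4)]]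
    by (auto simp: zero_less_mult_iff mult_less_0_iff)
  have C: "A \<in> carrier_mat n n"
    and c1: "\<And>i k j. i < k \<Longrightarrow> k < j \<Longrightarrow> j < n \<Longrightarrow> A $$ (i, j) = A $$ (i, k) * A $$ (k, j) / A $$ (k, k)"
    and c2: "\<And>i j. j < i \<Longrightarrow> i < n \<Longrightarrow> i \<noteq> n - 1 \<Longrightarrow>
        A $$ (i, j) = A $$ (i, n - 1) * A $$ (n - 1, j) / A $$ (n - 1, n - 1)"
    and c3: "\<And>j. j < n - 1 \<Longrightarrow> A $$ (n - 1, j) = A $$ (n - 1, 0) * A $$ (0, j) / A $$ (0, 0)"
    using A unfolding inverse_cyclic_def by blast+
  have entry: "A $$ (i, j) = x i * y j * (if i \<le> j then 1 else g)" if ij: "i < n" "j < n" for i j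
  proof (cases "i \<le> j")
    case True
    have via: "A $$ (0, k) = A $$ (0, i) * A $$ (i, k) / A $$ (i, i)" if k: "i \<le> k" "k < n" for k
    proof (cases "i = 0 \<or> i = k")
      case True
      then show ?thesis using nz[OF ij(1) ij(1)] by auto
    next
      case False
      then show ?thesis using c1[of 0 i k] k by linarith
    qed
    have in1: "i \<le> n - 1" "n - 1 < n" using ij by simp_all
    have "A $$ (i, i) \<noteq> 0" "A $$ (0, i) \<noteq> 0" "A $$ (i, n - 1) \<noteq> 0"
      using nz[OF ij(1) ij(1)] nz[OF _ ij(1), of 0] nz[OF ij(1) in1(2)] n by simp_all
    then show ?thesis
      unfolding x_def y_def via[OF True ij(2)] via[OF in1] using True by (simp add: field_simps)
  next
    case False
    then have j: "j < n - 1" using ij by simp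
    have "A $$ (i, j) = A $$ (i, n - 1) * A $$ (n - 1, j) / A $$ (n - 1, n - 1)"
    proof (cases "i = n - 1")
      case True
      then show ?thesis using nz[OF ij(1) ij(1)] by simp
    next
      case i: False
      then show ?thesis using c2[of j i] False ij(1) by linarith
    qed
    moreover have "A $$ (0, n - 1) \<noteq> 0" using n by (intro nz) simp_all
    ultimately show ?thesis
      unfolding c3[OF j] x_def y_def g_def using False by simp
  qed
  have "A = scaled_two_level n g x y"
    using C entry by (intro eq_matI) (auto simp: scaled_two_level_def)
  moreover have "0 < g" unfolding g_def using pos_mult n by simp
  moreover have "0 < e * x i" if "i < n" for i using that sgn by (simp add: x_def)
  moreover have "0 < y j" if "j < n" for j
    using pos_mult[of 0 j 0 "n - 1"] that n
    by (simp add: y_def zero_less_divide_iff zero_less_mult_iff)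
  ultimately show ?thesis using that by blast
qed

lemma inv_mat_eqI:
  assumes A: "A \<in> carrier_mat n n" and B: "B \<in> carrier_mat n n" and BA: "B * A = 1\<^sub>m n"
  shows "invertible_mat A" "inv_mat A = B"
proof -
  have AB: "A * B = 1\<^sub>m n" by (rule mat_mult_left_right_inverse[OF B A BA])
  show I: "invertible_mat A"
    using A B AB BA by (auto simp: invertible_mat_def inverts_mat_def)
  have "inv_mat A = B * A * inv_mat A" using inv_mat(1)[OF A I] by (simp add: BA)
  also have "\<dots> = B * (A * inv_mat A)" by (rule assoc_mult_mat[OF B A inv_mat(1)[OF A I]])
  also have "\<dots> = B" using B by (simp add: inv_mat(2)[OF A I])
  finally show "inv_mat A = B" .
qed

lemma diag_minus_cycle_prod_scaled_two_level:
  fixes x y :: "nat \<Rightarrow> real"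
  assumes n: "2 \<le> n" and F: "F = scaled_two_level n g x y"
  shows "(\<Prod>i<n. F $$ (i, i)) - (\<Prod>i<n - 1. F $$ (i, i + 1)) * F $$ (n - 1, 0)
    = (\<Prod>i<n. x i * y i) * (1 - g)"
proof -
  obtain m where m: "n = Suc m" "0 < m" using n by (cases n) auto
  have "(\<Prod>i<n - 1. F $$ (i, i + 1)) * F $$ (n - 1, 0) =
    (\<Prod>i<m. x i * y (Suc i)) * (x m * y 0 * g)"
    using m by (simp add: F scaled_two_level_def)
  also have "\<dots> = ((\<Prod>i<m. x i) * x m) * (y 0 * (\<Prod>i<m. y (Suc i))) * g"
    by (simp add: prod.distrib)
  also have "\<dots> = (\<Prod>i<n. x i * y i) * g"
    unfolding m prod.distrib by (simp only: prod.lessThan_Suc[of x] prod.lessThan_Suc_shift[of y])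
  finally show ?thesis by (simp add: F scaled_two_level_def algebra_simps)
qed

text \<open>Since \<open>\<Prod>x\<^sub>i y\<^sub>i\<close> has the sign \<open>e\<^sup>n\<close>, the condition \<open>e (1 - g) > 0\<close> is the same as
  \<open>e\<^sup>n\<^sup>+\<^sup>1 (d - c) > 0\<close>; this is where the parity of \<open>n\<close> enters.\<close>

lemma inverse_positive_cyc_bidiag_iff:
  fixes e :: real
  assumes n: "2 \<le> n" and A: "A \<in> carrier_mat n n" and e: "e = 1 \<or> e = - 1"
  shows "(invertible_mat A \<and> (\<exists>p r. inv_mat A = cyc_bidiag n p r \<and> (\<forall>i<n. 0 < p i \<and> 0 < r i)
      \<and> 0 < e * ((\<Prod>i<n. p i) - (\<Prod>i<n. r i)))) \<longleftrightarrow>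
    (\<forall>i<n. \<forall>j<n. 0 < e * A $$ (i, j)) \<and> inverse_cyclic n A \<and>
    0 < e ^ Suc n * ((\<Prod>i<n. A $$ (i, i)) - (\<Prod>i<n - 1. A $$ (i, i + 1)) * A $$ (n - 1, 0))"
    (is "?L \<longleftrightarrow> ?R")
proof -
  have n0: "0 < n" using n by simp
  have ee: "e * e = 1" using e by auto
  have sign: "0 < e ^ Suc n * ((\<Prod>i<n. x i * y i) * (1 - g)) \<longleftrightarrow> 0 < e * (1 - g)"
    if "\<And>i. i < n \<Longrightarrow> 0 < e * x i" "\<And>i. i < n \<Longrightarrow> 0 < y i" for x y g
  proof -
    have "e ^ Suc n * ((\<Prod>i<n. x i * y i) * (1 - g)) = (\<Prod>i<n. e * x i * y i) * (e * (1 - g))"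
      by (simp add: prod.distrib)
    moreover have "0 < (\<Prod>i<n. e * x i * y i)" using that by (intro prod_pos) auto
    moreover have "0 < u * w \<longleftrightarrow> 0 < w" if "0 < u" for u w :: real
      using that by (simp add: zero_less_mult_iff)
    ultimately show ?thesis by (simp only:)
  qed
  show ?thesis
  proof
    assume ?L
    then obtain p r where inv: "invertible_mat A" "inv_mat A = cyc_bidiag n p r"
      and pos: "\<And>i. i < n \<Longrightarrow> 0 < p i" "\<And>i. i < n \<Longrightarrow> 0 < r i"
      and less: "0 < e * ((\<Prod>i<n. p i) - (\<Prod>i<n. r i))" by blast
    let ?P = "\<Prod>i<n. p i" and ?Q = "\<Prod>i<n. r i"
    have P: "0 < ?P" "0 < ?Q" using pos by (auto intro!: prod_pos)
    define g where "g = ?Q / ?P"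
    have "0 < e * (1 - v / u)" if "0 < u" "0 < e * (u - v)" for u v :: real
    proof -
      have "e * (1 - v / u) = e * (u - v) / u" using that(1) by (simp add: field_simps)
      then show ?thesis using that by simp
    qed
    from this[OF P(1) less] have g: "0 < g" "0 < e * (1 - g)"
      using divide_pos_pos[OF P(2,1)] by (simp_all only: g_def)
    \<comment> \<open>The monodromy of the chain solution is \<open>P / R = 1 / g\<close>, which is the wrap factor that the
      two-level form asks for.\<close>
    define v where "v i = (\<Prod>k<i. p k / r k)" for i
    have v: "0 < v i" if "i \<le> n" for i
      unfolding v_def using pos that by (intro prod_pos) auto
    define x where "x i = e * v i" for i
    define y where "y i = 1 / (p i * v i * (e * (1 - g)))" for i
    have BF: "cyc_bidiag n p r * scaled_two_level n g x y = 1\<^sub>m n"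
    proof (rule cyc_bidiag_mult_scaled_two_level)
      show "p i * x i * y i * (1 - g) = 1" if "i < n" for i
      proof -
        have "e \<noteq> 0" "g \<noteq> 1" using g by auto
        then show ?thesis using pos(1)[OF that] v[of i] that by (simp add: x_def y_def)
      qed
      show "p i * x i = r i * x (cyc_succ n i) * (if cyc_succ n i = 0 then 1 / g else 1)"
        if "i < n" for i
      proof -
        have "r k \<noteq> 0" "p k \<noteq> 0" if "k < n" for k using pos[OF that] by simp_all
        from cyclic_chain_monodromy[of n r p i, OF this that]
        have "p i * v i = r i * v (cyc_succ n i) * (if cyc_succ n i = 0 then 1 / g else 1)"
          by (simp only: v_def g_def divide_divide_eq_right mult_1)
        then show ?thesis by (simp add: x_def)
      qed
    qed (use g in simp)
    let ?F = "scaled_two_level n g x y"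
    have "A = A * (inv_mat A * ?F)" using A by (simp add: BF inv(2))
    also have "\<dots> = A * inv_mat A * ?F"
      by (rule assoc_mult_mat[symmetric, OF A inv_mat(1)[OF A inv(1)] scaled_two_level_carrier])
    also have "\<dots> = ?F" by (simp add: inv_mat(2)[OF A inv(1)] left_mult_one_mat[OF scaled_two_level_carrier])
    finally have A_eq: "A = ?F" .
    have ex: "0 < e * x i" if "i < n" for i
      using v[of i] that ee by (simp add: x_def flip: mult.assoc)
    have y: "0 < y i" if "i < n" for i
      using v[of i] that pos g by (simp add: y_def)
    have "0 < e * A $$ (i, j)" if "i < n" "j < n" for i j
    proof -
      have "0 < e * x i * y j * (if i \<le> j then 1 else g)" using ex y that g by simp
      then show ?thesis using that by (simp add: A_eq scaled_two_level_def mult.assoc)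
    qed
    moreover have "inverse_cyclic n A"
      unfolding A_eq using ex y by (intro inverse_cyclic_scaled_two_level) force+
    ultimately show ?R
      using sign[of x y g, OF ex y] g
      by (simp only: diag_minus_cycle_prod_scaled_two_level[OF n A_eq]) blast
  next
    assume R: ?R
    then obtain g x y where A_eq: "A = scaled_two_level n g x y" and g: "0 < g"
      and ex: "\<And>i. i < n \<Longrightarrow> 0 < e * x i" and y: "\<And>j. j < n \<Longrightarrow> 0 < y j"
      using inverse_cyclic_imp_scaled_two_level[OF n0, of A e] by blast
    have eg: "0 < e * (1 - g)"
      using R sign[of x y g, OF ex y] unfolding diag_minus_cycle_prod_scaled_two_level[OF n A_eq] by blast
    \<comment> \<open>These values are forced by the hypotheses of \<open>cyc_bidiag_mult_scaled_two_level\<close>; each \<open>x\<^sub>i\<close> and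
      \<open>1 - g\<close> is paired with a factor \<open>e\<close> to make the signs visible.\<close>
    define p where "p i = 1 / ((e * x i) * y i * (e * (1 - g)))" for i
    define r where "r i = p i * ((e * x i) / (e * x (cyc_succ n i))) * (if cyc_succ n i = 0 then g else 1)" for i
    have e0: "e \<noteq> 0" and g1: "g \<noteq> 1" using eg by auto
    have xnz: "x i \<noteq> 0" if "i < n" for i using ex[OF that] by auto
    have p: "0 < p i" if "i < n" for i using ex y that eg by (simp add: p_def)
    have r: "0 < r i" if "i < n" for i
    proof -
      have "0 < (if cyc_succ n i = 0 then g else 1)" using g by simp
      with p[OF that] divide_pos_pos[OF ex[OF that] ex[OF cyc_succ_less[OF that]]]
      show ?thesis unfolding r_def by (intro mult_pos_pos)
    qed
    have chain: "p i * x i = r i * x (cyc_succ n i) * (if cyc_succ n i = 0 then 1 / g else 1)"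
      if "i < n" for i
      using xnz[OF that] xnz[OF cyc_succ_less[OF that]] e0 g by (simp add: r_def)
    have pe: "p i = 1 / (x i * y i * (1 - g))" for i
    proof -
      have "(e * x i) * y i * (e * (1 - g)) = (e * e) * (x i * y i * (1 - g))" by (simp add: algebra_simps)
      then show ?thesis by (simp add: p_def ee)
    qed
    have "cyc_bidiag n p r * A = 1\<^sub>m n"
      unfolding A_eq
    proof (rule cyc_bidiag_mult_scaled_two_level[OF _ chain])
      show "p i * x i * y i * (1 - g) = 1" if "i < n" for i
        using xnz[OF that] y[OF that] g1 by (simp add: pe)
    qed (use g in auto)
    note inv = inv_mat_eqI[OF A cyc_bidiag_carrier this]
    have "(\<Prod>i<n. r i) = g * (\<Prod>i<n. p i)"
    proof -
      have "(\<Prod>i<n. if cyc_succ n i = 0 then g else 1) = (\<Prod>i<n. if i = 0 then g else 1)"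
        by (rule prod_cyc_succ)
      also have "\<dots> = g" using n0 by simp
      finally have wrap: "(\<Prod>i<n. if cyc_succ n i = 0 then g else 1) = g" .
      define u where "u i = e * x i" for i
      have "(\<Prod>i<n. u i) / (\<Prod>i<n. u (cyc_succ n i)) = 1"
        unfolding prod_cyc_succ using xnz e0 by (intro divide_self) (simp add: u_def)
      moreover have "(\<Prod>i<n. r i) =
          (\<Prod>i<n. p i) * ((\<Prod>i<n. u i) / (\<Prod>i<n. u (cyc_succ n i))) * g"
        unfolding r_def u_def[symmetric] prod.distrib prod_dividef wrap ..
      ultimately show ?thesis by (simp only: mult_1_right mult.commute)
    qed
    then have "e * ((\<Prod>i<n. p i) - (\<Prod>i<n. r i)) = (\<Prod>i<n. p i) * (e * (1 - g))"
      by (simp add: algebra_simps)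
    moreover have "0 < (\<Prod>i<n. p i)" using p by (intro prod_pos) auto
    ultimately have "0 < e * ((\<Prod>i<n. p i) - (\<Prod>i<n. r i))"
      using mult_pos_pos[OF _ eg, of "\<Prod>i<n. p i"] by presburger
    then show ?L using inv p r by blast
  qed
qed

text \<open>If the products agree, the chain solution \<open>v\<close> is a nonzero kernel vector. The matrix \<open>V\<close> with
  all columns equal to \<open>v\<close> turns this into a statement about matrix products.\<close>

lemma invertible_cyc_bidiag_imp_prod_neq:
  assumes n: "0 < n" and X: "F * cyc_bidiag n p r = 1\<^sub>m n" "F \<in> carrier_mat n n"
    and nz: "\<And>i. i < n \<Longrightarrow> p i \<noteq> 0 \<and> r i \<noteq> 0"
  shows "(\<Prod>i<n. p i) \<noteq> (\<Prod>i<n. r i)"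
proof
  assume eq: "(\<Prod>i<n. p i) = (\<Prod>i<n. r i)"
  define v where "v i = (\<Prod>k<i. p k / r k)" for i
  define V where "V = mat n n (\<lambda>(i, j). v i)"
  have V: "V \<in> carrier_mat n n" by (simp add: V_def)
  have "p i * v i = r i * v (cyc_succ n i)" if "i < n" for i
  proof -
    have "r k \<noteq> 0" "p k \<noteq> 0" if "k < n" for k using nz[OF that] by simp_all
    from cyclic_chain_monodromy[of n r p i, OF this that]
    have "p i * v i =
        r i * v (cyc_succ n i) * (if cyc_succ n i = 0 then (\<Prod>k<n. r k) / (\<Prod>k<n. r k) else 1)"
      unfolding v_def eq .
    moreover have "(\<Prod>k<n. r k) / (\<Prod>k<n. r k) = 1" using nz by (intro divide_self) simp
    ultimately show ?thesis by (simp only: if_cancel mult_1_right)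
  qed
  then have BV: "cyc_bidiag n p r * V = 0\<^sub>m n n"
    using V cyc_succ_less
    by (intro eq_matI) (auto simp: cyc_bidiag_mult_index simp del: index_mult_mat(1), auto simp: V_def cyc_bidiag_def)
  have "V = F * cyc_bidiag n p r * V" using V by (simp add: X(1))
  also have "\<dots> = F * 0\<^sub>m n n"
    unfolding BV[symmetric] by (rule assoc_mult_mat[OF X(2) cyc_bidiag_carrier V])
  finally have "V = F * 0\<^sub>m n n" .
  then have "V $$ (0, 0) = 0" using X n by simp
  then show False using n by (simp add: V_def v_def)
qed

theorem theorem3p1:
  fixes n :: nat and A :: "real mat" and c d :: real
  assumes "2 \<le> n" and "A \<in> carrier_mat n n"
    and "d = (\<Prod>i<n. A $$ (i, i))"
    and "c = (\<Prod>i<n - 1. A $$ (i, i + 1)) * A $$ (n - 1, 0)"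
  shows "(inverse_M_matrix n A \<and> bdsw n (inv_mat A) \<longleftrightarrow>
            pos_mat A \<and> d - c > 0 \<and> inverse_cyclic n A)
       \<and> (even n \<longrightarrow>
            (inverse_N_matrix n A \<and> bdsw n (inv_mat A) \<longleftrightarrow>
              neg_mat A \<and> inverse_cyclic n A \<and> d - c < 0))
       \<and> (odd n \<longrightarrow>
            (inverse_N_matrix n A \<and> bdsw n (inv_mat A) \<longleftrightarrow>
              neg_mat A \<and> inverse_cyclic n A \<and> d - c > 0))"
proof -
  note n = assms(1) and A = assms(2)
  have M: "inverse_M_matrix n A \<and> bdsw n (inv_mat A) \<longleftrightarrow>
    invertible_mat A \<and> (\<exists>p r. inv_mat A = cyc_bidiag n p r \<and> (\<forall>i<n. 0 < p i \<and> 0 < r i)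
      \<and> 0 < 1 * ((\<Prod>i<n. p i) - (\<Prod>i<n. r i)))" (is "?L \<longleftrightarrow> ?R")
  proof
    assume L: ?L
    then have inv: "invertible_mat A" and M: "M_matrix n (inv_mat A)"
      by (auto simp: inverse_M_matrix_def)
    obtain p r where pr: "inv_mat A = cyc_bidiag n p r" "\<And>i. i < n \<Longrightarrow> p i \<noteq> 0 \<and> r i \<noteq> 0"
      using L bdsw_iff_cyc_bidiag[OF n] by blast
    have "(\<Prod>i<n. p i) \<noteq> (\<Prod>i<n. r i)"
      using inv_mat(2)[OF A inv] n pr A by (intro invertible_cyc_bidiag_imp_prod_neq[of n A]) auto
    then show ?R using M inv pr M_matrix_cyc_bidiag_iff[of n r p] n by auto
  next
    assume ?R
    then obtain p r where *: "invertible_mat A" "inv_mat A = cyc_bidiag n p r"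
      "\<And>i. i < n \<Longrightarrow> 0 < p i \<and> 0 < r i" "(\<Prod>i<n. r i) < (\<Prod>i<n. p i)" by auto
    have nz: "p i \<noteq> 0 \<and> r i \<noteq> 0" if "i < n" for i using *(3)[OF that] by simp
    have "bdsw n (inv_mat A)" using *(2) nz bdsw_iff_cyc_bidiag[OF n] by blast
    moreover have "M_matrix n (inv_mat A)"
      using * nz M_matrix_cyc_bidiag_iff[of n r p] n by auto
    ultimately show ?L using * A by (simp add: inverse_M_matrix_def)
  qed
  have N: "inverse_N_matrix n A \<and> bdsw n (inv_mat A) \<longleftrightarrow>
    invertible_mat A \<and> (\<exists>p r. inv_mat A = cyc_bidiag n p r \<and> (\<forall>i<n. 0 < p i \<and> 0 < r i)
      \<and> 0 < - 1 * ((\<Prod>i<n. p i) - (\<Prod>i<n. r i)))" (is "?L \<longleftrightarrow> ?R")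
  proof
    assume L: ?L
    then obtain p r where pr: "inv_mat A = cyc_bidiag n p r" "\<And>i. i < n \<Longrightarrow> p i \<noteq> 0 \<and> r i \<noteq> 0"
      using bdsw_iff_cyc_bidiag[OF n] by blast
    then show ?R using L N_matrix_cyc_bidiag_iff[of n r p] n by (auto simp: inverse_N_matrix_def)
  next
    assume ?R
    then obtain p r where *: "invertible_mat A" "inv_mat A = cyc_bidiag n p r"
      "\<And>i. i < n \<Longrightarrow> 0 < p i \<and> 0 < r i" "(\<Prod>i<n. p i) < (\<Prod>i<n. r i)" by auto
    have nz: "p i \<noteq> 0 \<and> r i \<noteq> 0" if "i < n" for i using *(3)[OF that] by simp
    have "bdsw n (inv_mat A)" using *(2) nz bdsw_iff_cyc_bidiag[OF n] by blast
    moreover have "N_matrix n (inv_mat A)"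
      using * nz N_matrix_cyc_bidiag_iff[of n r p] n by auto
    ultimately show ?L using * A by (simp add: inverse_N_matrix_def)
  qed
  have pos: "pos_mat A \<longleftrightarrow> (\<forall>i<n. \<forall>j<n. 0 < 1 * A $$ (i, j))"
    and neg: "neg_mat A \<longleftrightarrow> (\<forall>i<n. \<forall>j<n. 0 < - 1 * A $$ (i, j))"
    using A by (auto simp: pos_mat_def neg_mat_def)
  have s1: "0 < (1::real) ^ Suc n * (d - c) \<longleftrightarrow> 0 < d - c"
    and s2: "even n \<Longrightarrow> 0 < (- 1::real) ^ Suc n * (d - c) \<longleftrightarrow> d - c < 0"
    and s3: "odd n \<Longrightarrow> 0 < (- 1::real) ^ Suc n * (d - c) \<longleftrightarrow> 0 < d - c"
    by simp_all
  have i1: "inverse_M_matrix n A \<and> bdsw n (inv_mat A) \<longleftrightarrow>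
      pos_mat A \<and> inverse_cyclic n A \<and> 0 < (1::real) ^ Suc n * (d - c)"
    unfolding M pos assms(3,4) by (rule inverse_positive_cyc_bidiag_iff[OF n A]) simp
  have i2: "inverse_N_matrix n A \<and> bdsw n (inv_mat A) \<longleftrightarrow>
      neg_mat A \<and> inverse_cyclic n A \<and> 0 < (- 1::real) ^ Suc n * (d - c)"
    unfolding N neg assms(3,4) by (rule inverse_positive_cyc_bidiag_iff[OF n A]) simp
  show ?thesis using i1 i2 s1 s2 s3 by blast
qed

end
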